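(* Let $G$ be a connected triangle-free graph with at least three vertices. Then $(G,k)$ is niche-realizable for some integer $k\ge 3$ if and only if $k\in\{3,4,5\}$ and $G$ is isomorphic to a member of $\{P_3,P_4,P_5,C_5,C_6,G_4,G_5\}$ when $k=3$; of $\{P_4,C_5\}$ when $k=4$; of $\{C_5\}$ when $k=5$.
   Context: $P_n$ and $C_n$ denote the path and cycle on $n$ vertices. $G_4$ is the graph on vertices $a,b,c,d,e$ with edges $ab,ad,bc,cd,de,eb$ (isomorphic to $K_{2,3}$). $G_5$ is the graph on vertices $x_1,\dots,x_6$ with edges $x_1x_2,x_2x_3,x_3x_4,x_4x_5,x_5x_6,x_6x_1,x_1x_4,x_2x_5,x_3x_6$ (isomorphic to $K_{3,3}$). A $k$-partite tournament is an orientation of a complete $k$-partite graph with $k$ nonempty partite sets. The niche graph $\mathcal{N}(D)$ of a digraph $D$ has vertex set $V(D)$, and two distinct vertices are adjacent iff they have a common out-neighbor in $D$ or a common in-neighbor in $D$. The pair $(G,k)$ is niche-realizable if $G$ is isomorphic to the niche graph of some $k$-partite tournament. *)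

theory Defs
  imports
    "Graph_Theory.Digraph_Isomorphism"
    "HOL-Library.Disjoint_Sets"
begin

text \<open>
  A finite simple undirected graph is a \<^locale>\<open>pair_graph\<close>: a finite, symmetric, loop-free
  digraph, in which an edge \<open>uv\<close> is the pair of arcs \<open>(u, v)\<close> and \<open>(v, u)\<close>.
  Isomorphism and connectedness are those of the library, reached through \<^const>\<open>with_proj\<close>.
\<close>

definition triangle_free :: "'a pair_pre_digraph \<Rightarrow> bool" where
  "triangle_free G \<longleftrightarrow>
     (\<nexists>u v w. (u, v) \<in> parcs G \<and> (v, w) \<in> parcs G \<and> (w, u) \<in> parcs G)"

definition complete_multipartite :: "nat \<Rightarrow> 'a pair_pre_digraph \<Rightarrow> bool" where
  "complete_multipartite k H \<longleftrightarrow> pair_graph H \<and>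
     (\<exists>P. partition_on (pverts H) P \<and> card P = k \<and>
        parcs H = {(u, v). u \<in> pverts H \<and> v \<in> pverts H \<and> \<not> (\<exists>A\<in>P. u \<in> A \<and> v \<in> A)})"

definition orientation_of :: "'a pair_pre_digraph \<Rightarrow> 'a pair_pre_digraph \<Rightarrow> bool" where
  "orientation_of D H \<longleftrightarrow> pverts D = pverts H \<and>
     parcs D \<union> (parcs D)\<inverse> = parcs H \<and> parcs D \<inter> (parcs D)\<inverse> = {}"

definition multipartite_tournament :: "nat \<Rightarrow> 'a pair_pre_digraph \<Rightarrow> bool" where
  "multipartite_tournament k D \<longleftrightarrow> (\<exists>H. complete_multipartite k H \<and> orientation_of D H)"

definition niche_graph :: "'a pair_pre_digraph \<Rightarrow> 'a pair_pre_digraph" where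
  "niche_graph D = \<lparr> pverts = pverts D,
     parcs = {(u, v). u \<in> pverts D \<and> v \<in> pverts D \<and> u \<noteq> v \<and>
       ((\<exists>w\<in>pverts D. (u, w) \<in> parcs D \<and> (v, w) \<in> parcs D) \<or>
        (\<exists>w\<in>pverts D. (w, u) \<in> parcs D \<and> (w, v) \<in> parcs D))} \<rparr>"

text \<open>
  HOL cannot quantify over the vertex type of the tournament inside a formula. Tournaments are
  finite, so taking natural numbers as their vertices loses no generality up to isomorphism.
\<close>

definition niche_realizable :: "'a pair_pre_digraph \<Rightarrow> nat \<Rightarrow> bool" where
  "niche_realizable G k \<longleftrightarrow>
     (\<exists>D :: nat pair_pre_digraph. multipartite_tournament k D \<and>
        digraph_iso (with_proj G) (with_proj (niche_graph D)))"

definition path_graph :: "nat \<Rightarrow> nat pair_pre_digraph" where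
  "path_graph n = \<lparr> pverts = {..<n}, parcs = symcl {(i, Suc i) | i. Suc i < n} \<rparr>"

text \<open>A simple graph only for \<open>n \<ge> 3\<close>.\<close>

definition cycle_graph :: "nat \<Rightarrow> nat pair_pre_digraph" where
  "cycle_graph n = \<lparr> pverts = {..<n}, parcs = symcl {(i, Suc i mod n) | i. i < n} \<rparr>"

text \<open>The vertices \<open>a, b, c, d, e\<close> are \<open>0, 1, 2, 3, 4\<close>.\<close>

definition G4 :: "nat pair_pre_digraph" where
  "G4 = \<lparr> pverts = {0, 1, 2, 3, 4},
     parcs = symcl {(0, 1), (0, 3), (1, 2), (2, 3), (3, 4), (4, 1)} \<rparr>"

text \<open>The vertex \<open>x\<^sub>i\<close> is \<open>i\<close>.\<close>

definition G5 :: "nat pair_pre_digraph" where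
  "G5 = \<lparr> pverts = {1, 2, 3, 4, 5, 6},
     parcs = symcl {(1, 2), (2, 3), (3, 4), (4, 5), (5, 6), (6, 1), (1, 4), (2, 5), (3, 6)} \<rparr>"

end

theory Submission
  imports Defs
begin

text \<open>
  If the niche graph of a \<open>k\<close>-partite tournament is triangle-free, then all out-degrees and all
  in-degrees are at most two, because three common out-neighbours (or in-neighbours) of a vertex
  form a triangle. A vertex of a part \<open>A\<close> is joined to all vertices outside \<open>A\<close>, so at most four
  vertices lie outside any part. For \<open>k \<ge> 3\<close> this leaves only eight lists of part sizes, with at most
  six vertices. For each of them a verified search runs through the orientations that respect the
  degree bound and finds that every niche graph contains a triangle, is disconnected, or is one of
  the graphs in the statement.
\<close>

section \<open>Finite graphs as lists\<close>

text \<open>Each edge is listed in one direction only. The vertices form a list because their order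
  is used when isomorphisms are searched for.\<close>

definition list_graph :: "'a list \<times> ('a \<times> 'a) list \<Rightarrow> 'a pair_pre_digraph" where
  "list_graph H = \<lparr> pverts = set (fst H), parcs = symcl (set (snd H)) \<rparr>"

text \<open>Niche adjacency as an operation on the arc relation alone; \<open>w\<close> can range
  over the whole type because arcs of a tournament stay within its vertex set.\<close>

definition niche_rel :: "'a rel \<Rightarrow> 'a rel" where
  "niche_rel R = {(u, v). u \<noteq> v \<and>
     ((\<exists>w. (u, w) \<in> R \<and> (v, w) \<in> R) \<or> (\<exists>w. (w, u) \<in> R \<and> (w, v) \<in> R))}"

lemma niche_rel_sym: "(u, v) \<in> niche_rel R \<Longrightarrow> (v, u) \<in> niche_rel R"
  by (auto simp: niche_rel_def)

lemma parcs_niche_graph: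
  assumes "parcs D \<subseteq> pverts D \<times> pverts D"
  shows "parcs (niche_graph D) = niche_rel (parcs D)"
  using assms unfolding niche_graph_def niche_rel_def by auto

lemma niche_rel_subset: "R \<subseteq> V \<times> V \<Longrightarrow> niche_rel R \<subseteq> V \<times> V"
  unfolding niche_rel_def by auto

lemma pair_wf_niche_graph: "pair_wf_digraph (niche_graph D)"
  by unfold_locales (auto simp: niche_graph_def)

lemma pverts_niche_graph [simp]: "pverts (niche_graph D) = pverts D"
  by (simp add: niche_graph_def)

section \<open>Isomorphisms and connectedness of pair digraphs\<close>

text \<open>An isomorphism of the library also carries an arc map and new head and tail functions.
  For arcs that are pairs, a vertex map \<open>f\<close> forces the arc map
  \<open>map_prod f f\<close>.\<close>

lemma digraph_isoI:
  assumes "pair_wf_digraph G" "inj_on f (pverts G)" "pverts H = f ` pverts G"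
    "parcs H = map_prod f f ` parcs G"
  shows "digraph_iso (with_proj G) (with_proj H)"
proof -
  interpret pair_wf_digraph G by fact
  let ?h = "\<lparr> iso_verts = f, iso_arcs = map_prod f f, iso_head = snd, iso_tail = fst \<rparr>"
  have "parcs G \<subseteq> pverts G \<times> pverts G"
    using arc_fst_in_verts arc_snd_in_verts by fastforce
  then have "inj_on (map_prod f f) (parcs G)"
    using map_prod_inj_on[OF assms(2) assms(2)] inj_on_subset by blast
  then have "pre_digraph.digraph_isomorphism (with_proj G) ?h"
    using assms(1,2) by (simp add: pre_digraph.digraph_isomorphism_def wf_digraph_wp_iff)
  moreover have "with_proj H = app_iso ?h (with_proj G)"
    using assms(3,4) by (simp add: app_iso_def with_proj_def)
  ultimately show ?thesis
    unfolding digraph_iso_def by blast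
qed

text \<open>The converse reduction: since \<open>with_proj H\<close> has tail \<open>fst\<close> and
  head \<open>snd\<close>, compatibility of the arc map with tails and heads leaves only
  \<open>map_prod\<close>.\<close>

lemma digraph_isoE:
  assumes "digraph_iso (with_proj G) (with_proj H)"
  obtains f where "inj_on f (pverts G)" "pverts H = f ` pverts G" "parcs H = map_prod f f ` parcs G"
proof -
  obtain h where h: "pre_digraph.digraph_isomorphism (with_proj G) h"
    "with_proj H = app_iso h (with_proj G)"
    using assms unfolding digraph_iso_def by blast
  have H: "pverts H = iso_verts h ` pverts G" "parcs H = iso_arcs h ` parcs G"
    "iso_tail h = fst" "iso_head h = snd"
    using h(2) by (simp_all add: app_iso_def with_proj_def)
  have "iso_arcs h e = map_prod (iso_verts h) (iso_verts h) e" if "e \<in> parcs G" for e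
    using h(1) that H(3,4) by (auto simp: pre_digraph.digraph_isomorphism_def prod_eq_iff)
  then have "parcs H = map_prod (iso_verts h) (iso_verts h) ` parcs G"
    using H(2) by simp
  then show ?thesis
    using that[of "iso_verts h"] h(1) H(1) by (auto simp: pre_digraph.digraph_isomorphism_def)
qed

lemma triangle_free_iso:
  assumes "digraph_iso (with_proj G) (with_proj H)" "pair_wf_digraph G" "triangle_free G"
  shows "triangle_free H"
  unfolding triangle_free_def
proof
  interpret pair_wf_digraph G by fact
  assume "\<exists>u v w. (u, v) \<in> parcs H \<and> (v, w) \<in> parcs H \<and> (w, u) \<in> parcs H"
  then obtain u v w where uvw: "(u, v) \<in> parcs H" "(v, w) \<in> parcs H" "(w, u) \<in> parcs H"
    by blast
  obtain f where f: "inj_on f (pverts G)" "parcs H = map_prod f f ` parcs G"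
    using digraph_isoE[OF assms(1)] by metis
  have arc: "\<exists>a b. (a, b) \<in> parcs G \<and> x = f a \<and> y = f b \<and> a \<in> pverts G \<and> b \<in> pverts G"
    if "(x, y) \<in> parcs H" for x y
    using that f(2) arc_fst_in_verts arc_snd_in_verts by fastforce
  \<comment> \<open>The three arcs are pulled back separately, so each corner of the triangle has
    two preimages at first; injectivity of \<open>f\<close> merges them.\<close>
  from uvw arc obtain a b b' c c' a' where
    "(a, b) \<in> parcs G" "(b', c) \<in> parcs G" "(c', a') \<in> parcs G"
    "u = f a" "v = f b" "v = f b'" "w = f c" "w = f c'" "u = f a'"
    "{a, b, b', c, c', a'} \<subseteq> pverts G"
    by (metis empty_subsetI insert_subset)
  with f(1) have "b' = b" "c' = c" "a' = a"
    by (auto dest: inj_onD)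
  then show False
    using assms(3) \<open>(a, b) \<in> _\<close> \<open>(b', c) \<in> _\<close> \<open>(c', a') \<in> _\<close>
    unfolding triangle_free_def by blast
qed

text \<open>The map \<open>xs ! i\<close> to \<open>ys ! i\<close> is the isomorphism. This is the
  form in which the search delivers its matches.\<close>

lemma digraph_iso_listsI:
  assumes "pair_wf_digraph G" "distinct xs" "set xs = pverts G"
    "pair_wf_digraph H" "distinct ys" "set ys = pverts H" "length xs = length ys"
    and arcs: "\<And>i j. i < length xs \<Longrightarrow> j < length xs \<Longrightarrow>
      (xs ! i, xs ! j) \<in> parcs G \<longleftrightarrow> (ys ! i, ys ! j) \<in> parcs H"
  shows "digraph_iso (with_proj G) (with_proj H)"
proof -
  interpret G: pair_wf_digraph G by fact
  interpret H: pair_wf_digraph H by fact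
  let ?n = "length xs"
  have bx: "bij_betw (nth xs) {..<?n} (pverts G)"
    using bij_betw_nth[OF assms(2)] assms(3) by blast
  have by': "bij_betw (nth ys) {..<?n} (pverts H)"
    using bij_betw_nth[OF assms(5)] assms(6,7) by simp
  define f where "f = nth ys \<circ> inv_into {..<?n} (nth xs)"
  have bf: "bij_betw f (pverts G) (pverts H)"
    unfolding f_def using bij_betw_trans[OF bij_betw_inv_into[OF bx] by'] .
  have f: "f (xs ! i) = ys ! i" if "i < ?n" for i
    using bij_betw_inv_into_left[OF bx, of i] that by (simp add: f_def)
  have vG: "\<exists>i<?n. u = xs ! i" if "u \<in> pverts G" for u
    using that assms(3) by (metis in_set_conv_nth)
  have vH: "\<exists>i<?n. u = ys ! i" if "u \<in> pverts H" for u
    using that assms(6,7) by (metis in_set_conv_nth)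
  have "parcs H = map_prod f f ` parcs G"
  proof (intro equalityI subsetI)
    fix e assume e: "e \<in> parcs H"
    then obtain i j where ij: "i < ?n" "j < ?n" "e = (ys ! i, ys ! j)"
      using vH[OF H.arc_fst_in_verts[OF e]] vH[OF H.arc_snd_in_verts[OF e]]
      by (metis prod.collapse)
    then have "(xs ! i, xs ! j) \<in> parcs G"
      using arcs e by blast
    then show "e \<in> map_prod f f ` parcs G"
      using f ij by (intro image_eqI[of _ _ "(xs ! i, xs ! j)"]) auto
  next
    fix e assume "e \<in> map_prod f f ` parcs G"
    then obtain d where d: "d \<in> parcs G" "e = map_prod f f d" by (elim imageE)
    then obtain i j where ij: "i < ?n" "j < ?n" "d = (xs ! i, xs ! j)"
      using vG[OF G.arc_fst_in_verts[OF d(1)]] vG[OF G.arc_snd_in_verts[OF d(1)]]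
      by (metis prod.collapse)
    then have "e = (ys ! i, ys ! j)"
      using d(2) f by simp
    then show "e \<in> parcs H"
      using arcs d(1) ij by blast
  qed
  then show ?thesis
    using digraph_isoI[OF assms(1), of f H] bf by (auto simp: bij_betw_def)
qed

text \<open>A walk that starts in \<open>S\<close> cannot leave it, yet it can reach every vertex.
  Hence a proper nonempty closed set certifies disconnectedness, which is what the search looks
  for.\<close>

lemma connected_closed_set:
  assumes "connected (with_proj N)" "pair_wf_digraph N" "S \<subseteq> pverts N" "S \<noteq> {}"
    and sym: "\<And>u v. (u, v) \<in> parcs N \<Longrightarrow> (v, u) \<in> parcs N"
    and closed: "\<And>u v. (u, v) \<in> parcs N \<Longrightarrow> u \<in> S \<Longrightarrow> v \<in> S"
  shows "S = pverts N"
proof -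
  obtain u where u: "u \<in> S" using assms(4) by blast
  \<comment> \<open>Connectedness in the library is strong connectedness of the symmetric closure,
    which changes nothing here.\<close>
  have p: "parcs (mk_symmetric (with_proj N)) = parcs N"
    using sym by (fastforce simp: parcs_mk_symmetric)
  have "v \<in> S" if "v \<in> pverts N" for v
  proof -
    have "u \<rightarrow>\<^sup>*\<^bsub>with_proj (mk_symmetric (with_proj N))\<^esub> v"
      using assms(1,3) u that by (auto simp: connected_def strongly_connected_def)
    then have "(u, v) \<in> rtrancl_on (pverts N) (parcs N)"
      by (simp add: reachable_def p)
    then show ?thesis
      using u by (induction rule: rtrancl_on_induct) (auto intro: closed)
  qed
  then show ?thesis using assms(3) by blast
qed

section \<open>An exhaustive search\<close>

definition out_list :: "('a \<times> 'a) list \<Rightarrow> 'a \<Rightarrow> 'a list" where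
  "out_list E u = map snd (filter (\<lambda>e. fst e = u) E)"

definition in_list :: "('a \<times> 'a) list \<Rightarrow> 'a \<Rightarrow> 'a list" where
  "in_list E u = map fst (filter (\<lambda>e. snd e = u) E)"

definition meet :: "'a list \<Rightarrow> 'a list \<Rightarrow> bool" where
  "meet xs ys \<longleftrightarrow> (\<exists>x\<in>set xs. x \<in> set ys)"

text \<open>
  The argument is a pair so that \<open>niche_pair E\<close> can be passed to \<^const>\<open>filter\<close> unapplied:
  symbolic evaluation would rewrite the body of an abstraction with variable arguments.
\<close>

definition niche_pair :: "('a \<times> 'a) list \<Rightarrow> 'a \<times> 'a \<Rightarrow> bool" where
  "niche_pair E p \<longleftrightarrow> fst p \<noteq> snd p \<and>
     (meet (out_list E (fst p)) (out_list E (snd p)) \<or> meet (in_list E (fst p)) (in_list E (snd p)))"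

lemma set_out_list: "set (out_list E u) = set E `` {u}"
  by (force simp: out_list_def)

lemma set_in_list: "set (in_list E u) = (set E)\<inverse> `` {u}"
  by (force simp: in_list_def)

lemma niche_pair_iff: "niche_pair E p \<longleftrightarrow> p \<in> niche_rel (set E)"
  by (cases p) (auto simp: niche_pair_def niche_rel_def meet_def set_out_list set_in_list)

text \<open>Adding the arc \<open>e\<close> can raise only the out-degree of its tail and the
  in-degree of its head, so only these two are tested.\<close>

definition degrees_le_2 :: "('a \<times> 'a) list \<Rightarrow> 'a \<times> 'a \<Rightarrow> bool" where
  "degrees_le_2 E e \<longleftrightarrow>
     length (remdups (out_list E (fst e))) \<le> 2 \<and> length (remdups (in_list E (snd e))) \<le> 2"

text \<open>Degrees are monotone in the arc set; hence pruning never cuts a partial orientation that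
  extends to an admissible \<open>R\<close>.\<close>

lemma degrees_le_2I:
  assumes "set E \<subseteq> R" "finite R" "\<And>u. card (R `` {u}) \<le> 2" "\<And>u. card (R\<inverse> `` {u}) \<le> 2"
  shows "degrees_le_2 E e"
proof -
  have "card (set E `` {fst e}) \<le> card (R `` {fst e})"
    using assms(1,2) by (intro card_mono finite_Image) auto
  moreover have "card ((set E)\<inverse> `` {snd e}) \<le> card (R\<inverse> `` {snd e})"
    using assms(1,2) by (intro card_mono finite_Image) auto
  ultimately show ?thesis
    using assms(3)[of "fst e"] assms(4)[of "snd e"]
    by (simp add: degrees_le_2_def length_remdups_card_conv set_out_list set_in_list)
qed

text \<open>Both directions of each pair are tried; a branch whose new arc breaks the degree bound
  counts as passed. \<open>E\<close> accumulates the arcs chosen so far.\<close>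

fun all_orientations ::
  "(('a \<times> 'a) list \<Rightarrow> bool) \<Rightarrow> ('a \<times> 'a) list \<Rightarrow> ('a \<times> 'a) list \<Rightarrow> bool" where
  "all_orientations Q [] E = Q E"
| "all_orientations Q ((i, j) # es) E =
     ((if degrees_le_2 ((i, j) # E) (i, j) then all_orientations Q es ((i, j) # E) else True) \<and>
      (if degrees_le_2 ((j, i) # E) (j, i) then all_orientations Q es ((j, i) # E) else True))"

text \<open>Follow the branch that always picks a direction present in \<open>R\<close>. It is never
  pruned, and the leaf at its end is the required \<open>E'\<close>.\<close>

lemma all_orientationsD:
  assumes "all_orientations Q es E" "set E \<subseteq> R" "finite R"
    "\<And>u. card (R `` {u}) \<le> 2" "\<And>u. card (R\<inverse> `` {u}) \<le> 2"
    "\<And>i j. (i, j) \<in> set es \<Longrightarrow> (i, j) \<in> R \<or> (j, i) \<in> R"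
  shows "\<exists>E'. Q E' \<and> set E \<subseteq> set E' \<and> set E' \<subseteq> R \<and>
    (\<forall>(i, j)\<in>set es. (i, j) \<in> set E' \<or> (j, i) \<in> set E')"
  using assms(1,2,6)
proof (induction Q es E rule: all_orientations.induct)
  case (1 Q E)
  then show ?case by auto
next
  case (2 Q i j es E)
  have R: "(i, j) \<in> R \<or> (j, i) \<in> R" and R': "\<And>i j. (i, j) \<in> set es \<Longrightarrow> (i, j) \<in> R \<or> (j, i) \<in> R"
    using "2.prems"(3) by auto
  from R show ?case
  proof
    assume ij: "(i, j) \<in> R"
    then have s: "set ((i, j) # E) \<subseteq> R" using "2.prems" by simp
    then have d: "degrees_le_2 ((i, j) # E) (i, j)" using degrees_le_2I assms(3-5) by blast
    with "2.prems" have "all_orientations Q es ((i, j) # E)" by simp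
    from "2.IH"(1)[OF d this s R'] show ?thesis by fastforce
  next
    assume ij: "(j, i) \<in> R"
    then have s: "set ((j, i) # E) \<subseteq> R" using "2.prems" by simp
    then have d: "degrees_le_2 ((j, i) # E) (j, i)" using degrees_le_2I assms(3-5) by blast
    with "2.prems" have "all_orientations Q es ((j, i) # E)" by simp
    from "2.IH"(2)[OF d this s R'] show ?thesis by fastforce
  qed
qed

section \<open>Classifying a single niche graph\<close>

text \<open>\<open>N\<close> will be a symmetric arc list, so out-lists are neighbourhoods, and a
  triangle is an edge whose ends have a common neighbour.\<close>

definition has_triangle :: "('a \<times> 'a) list \<Rightarrow> bool" where
  "has_triangle N \<longleftrightarrow> (\<exists>p\<in>set N. meet (out_list N (fst p)) (out_list N (snd p)))"

definition has_closed_part :: "'a list \<Rightarrow> ('a \<times> 'a) list \<Rightarrow> bool" where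
  "has_closed_part V N \<longleftrightarrow> (\<exists>S\<in>set (subseqs V). S \<noteq> [] \<and> length S < length V \<and>
     (\<forall>p\<in>set N. fst p \<in> set S \<longrightarrow> snd p \<in> set S))"

definition same_pattern :: "('a \<times> 'a) list \<Rightarrow> 'a list \<Rightarrow> 'b list \<times> ('b \<times> 'b) list \<Rightarrow> bool" where
  "same_pattern N p H \<longleftrightarrow> length p = length (fst H) \<and>
     (\<forall>i\<in>set [0..<length p]. \<forall>j\<in>set [0..<length p]. (p ! i, p ! j) \<in> set N \<longleftrightarrow>
        (fst H ! i, fst H ! j) \<in> set (snd H) \<or> (fst H ! j, fst H ! i) \<in> set (snd H))"

text \<open>
  The vertex order in which each target graph is listed below is a Hamiltonian path, so only
  enumerations that follow edges have to be tried.
\<close>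

fun extend_path ::
  "('a list \<Rightarrow> bool) \<Rightarrow> 'a list \<Rightarrow> ('a \<times> 'a) list \<Rightarrow> nat \<Rightarrow> 'a list \<Rightarrow> bool" where
  "extend_path Q V N 0 p = Q p"
| "extend_path Q V N (Suc k) p =
     (\<exists>v\<in>set V. v \<notin> set p \<and> (p = [] \<or> (v, hd p) \<in> set N) \<and> extend_path Q V N k (v # p))"

lemma extend_pathD:
  assumes "extend_path Q V N k p" "distinct p" "set p \<subseteq> set V"
  shows "\<exists>q. Q q \<and> distinct q \<and> set q \<subseteq> set V \<and> length q = length p + k"
  using assms
proof (induction Q V N k p rule: extend_path.induct)
  case (2 Q V N k p)
  then obtain v where "v \<in> set V" "v \<notin> set p" "extend_path Q V N k (v # p)" by auto
  with 2 have "\<exists>q. Q q \<and> distinct q \<and> set q \<subseteq> set V \<and> length q = length (v # p) + k" by auto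
  then show ?case by simp
qed auto

definition matches_some ::
  "('b list \<times> ('b \<times> 'b) list) list \<Rightarrow> ('a \<times> 'a) list \<Rightarrow> 'a list \<Rightarrow> bool" where
  "matches_some Hs N p \<longleftrightarrow> (\<exists>H\<in>set Hs. same_pattern N p H)"

text \<open>The simple triangle test comes first and the run through all subsets of \<open>V\<close>
  last.\<close>

definition classified ::
  "('b list \<times> ('b \<times> 'b) list) list \<Rightarrow> 'a list \<Rightarrow> ('a \<times> 'a) list \<Rightarrow> bool" where
  "classified Hs V N \<longleftrightarrow> has_triangle N \<or>
     extend_path (matches_some Hs N) V N (length V) [] \<or> has_closed_part V N"

definition niche_classified ::
  "('b list \<times> ('b \<times> 'b) list) list \<Rightarrow> 'a list \<Rightarrow> ('a \<times> 'a) list \<Rightarrow> bool" where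
  "niche_classified Hs V E = classified Hs V (filter (niche_pair E) (List.product V V))"

text \<open>The assumptions \<open>tf\<close> and \<open>conn\<close> exclude the first and the last
  alternative of \<open>classified\<close>; what remains is an enumeration \<open>p\<close> matching
  a target.\<close>

lemma niche_classifiedD:
  assumes "niche_classified Hs V E" "distinct V" "set E \<subseteq> set V \<times> set V"
    and tf: "\<And>u v w. (u, v) \<in> niche_rel (set E) \<Longrightarrow> (v, w) \<in> niche_rel (set E) \<Longrightarrow>
      (w, u) \<notin> niche_rel (set E)"
    and conn: "\<And>S. S \<subseteq> set V \<Longrightarrow> S \<noteq> {} \<Longrightarrow>
      (\<And>u v. (u, v) \<in> niche_rel (set E) \<Longrightarrow> u \<in> S \<Longrightarrow> v \<in> S) \<Longrightarrow> S = set V"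
  shows "\<exists>p H. H \<in> set Hs \<and> distinct p \<and> set p = set V \<and> length p = length (fst H) \<and>
    (\<forall>i<length p. \<forall>j<length p.
       (p ! i, p ! j) \<in> niche_rel (set E) \<longleftrightarrow> (fst H ! i, fst H ! j) \<in> symcl (set (snd H)))"
proof -
  let ?N = "filter (niche_pair E) (List.product V V)"
  have N: "set ?N = niche_rel (set E)"
    using niche_rel_subset[OF assms(3)] by (auto simp: niche_pair_iff)
  have "\<not> has_triangle ?N"
  proof
    assume "has_triangle ?N"
    then obtain u v w where "(u, v) \<in> niche_rel (set E)" "(u, w) \<in> niche_rel (set E)"
      "(v, w) \<in> niche_rel (set E)"
      unfolding has_triangle_def meet_def set_out_list N by force
    then show False using tf niche_rel_sym by metis
  qed
  moreover have "\<not> has_closed_part V ?N"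
  proof
    assume "has_closed_part V ?N"
    then obtain S where S: "S \<in> set (subseqs V)" "S \<noteq> []" "length S < length V"
      "\<And>u v. (u, v) \<in> niche_rel (set E) \<Longrightarrow> u \<in> set S \<Longrightarrow> v \<in> set S"
      unfolding has_closed_part_def N by force
    have "set S \<subseteq> set V"
      using S(1) subseqs_powset[of V] by blast
    then have "set S = set V"
      using conn S(2,4) by (metis set_empty)
    \<comment> \<open>\<open>S\<close> has fewer entries than the distinct list \<open>V\<close>, so
      it cannot cover the same set.\<close>
    then show False
      using S(3) assms(2) card_length[of S] distinct_card[of V] by simp
  qed
  ultimately have "extend_path (matches_some Hs ?N) V ?N (length V) []"
    using assms(1) unfolding niche_classified_def classified_def by blast
  then obtain p where p: "matches_some Hs ?N p" "distinct p" "set p \<subseteq> set V" "length p = length V"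
    by (auto dest: extend_pathD)
  then obtain H where H: "H \<in> set Hs" "same_pattern ?N p H"
    unfolding matches_some_def by blast
  \<comment> \<open>A repetition-free list in \<open>V\<close> with as many entries as
    \<open>V\<close> exhausts it.\<close>
  have "set p = set V"
    using p assms(2) by (intro card_subset_eq) (auto simp: distinct_card)
  then show ?thesis
    using H p(2) unfolding same_pattern_def N
    by (intro exI[of _ p] exI[of _ H]) (auto simp: symcl_def)
qed

section \<open>Orientations of the complete multipartite graphs with given part sizes\<close>

text \<open>Encodes a complete multipartite graph with consecutive parts: entry \<open>v\<close> is
  the number of the part that contains vertex \<open>v\<close>.\<close>

primrec colours :: "nat \<Rightarrow> nat list \<Rightarrow> nat list" where
  "colours i [] = []"
| "colours i (s # ss) = replicate s i @ colours (Suc i) ss"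

text \<open>Pairs are grouped by their larger end, so the search completes the orientation on an
  initial segment of vertices before adding the next vertex.\<close>

definition cross_pairs :: "nat list \<Rightarrow> (nat \<times> nat) list" where
  "cross_pairs c = [(i, j). j \<leftarrow> [0..<length c], i \<leftarrow> [0..<j], c ! i \<noteq> c ! j]"

definition check_parts :: "('b list \<times> ('b \<times> 'b) list) list \<Rightarrow> nat list \<Rightarrow> bool" where
  "check_parts Hs ss \<longleftrightarrow> (let c = colours 0 ss in
     all_orientations (niche_classified Hs [0..<length c]) (cross_pairs c) [])"

lemma colours_concat:
  "length (colours k (map length lss)) = length (concat lss)"
  "i < length (concat lss) \<Longrightarrow> \<exists>m<length lss.
     colours k (map length lss) ! i = k + m \<and> concat lss ! i \<in> set (lss ! m)"
proof (induction lss arbitrary: k i)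
  case (Cons l lss)
  { case 1 then show ?case using Cons.IH(1) by simp }
  { case 2
    show ?case
    proof (cases "i < length l")
      case True
      then show ?thesis by (intro exI[of _ 0]) (auto simp: nth_append)
    next
      case False
      then have "i - length l < length (concat lss)" using 2 by auto
      from Cons.IH(2)[OF this, of "Suc k"] obtain m where "m < length lss"
        "colours (Suc k) (map length lss) ! (i - length l) = Suc k + m"
        "concat lss ! (i - length l) \<in> set (lss ! m)" by blast
      then show ?thesis using False by (intro exI[of _ "Suc m"]) (auto simp: nth_append)
    qed }
qed auto

text \<open>The search yields an orientation inside \<open>R\<close> that covers all cross pairs. As
  \<open>R\<close> is itself an orientation of these pairs, the two coincide, and the verdict at the
  leaf applies to \<open>R\<close>.\<close>

lemma check_partsD:
  assumes check: "check_parts Hs ss" and R: "R \<subseteq> {..<n} \<times> {..<n}"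
    and c: "c = colours 0 ss" and n: "n = length c"
    and cross: "\<And>i j. i < n \<Longrightarrow> j < n \<Longrightarrow> (i, j) \<in> R \<or> (j, i) \<in> R \<longleftrightarrow> c ! i \<noteq> c ! j"
    and asym: "\<And>i j. (i, j) \<in> R \<Longrightarrow> (j, i) \<notin> R"
    and deg: "\<And>u. card (R `` {u}) \<le> 2" "\<And>u. card (R\<inverse> `` {u}) \<le> 2"
    and tf: "\<And>u v w. (u, v) \<in> niche_rel R \<Longrightarrow> (v, w) \<in> niche_rel R \<Longrightarrow> (w, u) \<notin> niche_rel R"
    and conn: "\<And>S. S \<subseteq> {..<n} \<Longrightarrow> S \<noteq> {} \<Longrightarrow>
      (\<And>u v. (u, v) \<in> niche_rel R \<Longrightarrow> u \<in> S \<Longrightarrow> v \<in> S) \<Longrightarrow> S = {..<n}"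
  shows "\<exists>p H. H \<in> set Hs \<and> distinct p \<and> set p = {..<n} \<and> length p = length (fst H) \<and>
    (\<forall>i<length p. \<forall>j<length p.
       (p ! i, p ! j) \<in> niche_rel R \<longleftrightarrow> (fst H ! i, fst H ! j) \<in> symcl (set (snd H)))"
proof -
  have V: "set [0..<n] = {..<n}" by auto
  have pairs: "set (cross_pairs c) = {(i, j). i < j \<and> j < n \<and> c ! i \<noteq> c ! j}"
    by (auto simp: cross_pairs_def n)
  have "finite R" using R finite_subset by blast
  have search: "all_orientations (niche_classified Hs [0..<n]) (cross_pairs c) []"
    using check by (simp add: check_parts_def c n Let_def)
  have R': "(i, j) \<in> R \<or> (j, i) \<in> R" if "(i, j) \<in> set (cross_pairs c)" for i j
    using that cross[of i j] by (simp add: pairs)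
  obtain E where E: "niche_classified Hs [0..<n] E" "set E \<subseteq> R"
    "\<forall>(i, j)\<in>set (cross_pairs c). (i, j) \<in> set E \<or> (j, i) \<in> set E"
    using all_orientationsD[OF search _ \<open>finite R\<close> deg R'] by auto
  have "R \<subseteq> set E"
  proof (rule subrelI)
    fix i j assume ij: "(i, j) \<in> R"
    then have "i < n" "j < n" using R by auto
    then have "c ! i \<noteq> c ! j" using ij cross by blast
    moreover have "i \<noteq> j" using \<open>c ! i \<noteq> c ! j\<close> by auto
    \<comment> \<open>A pair is listed only with its smaller index first, hence the split by
      order.\<close>
    ultimately have "(i, j) \<in> set E \<or> (j, i) \<in> set E"
      using E(3) \<open>i < n\<close> \<open>j < n\<close> unfolding pairs
      by (cases i j rule: linorder_cases) (auto, metis)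
    then show "(i, j) \<in> set E" using E(2) ij asym by blast
  qed
  with E(2) have "R = set E" by (rule equalityI[rotated])
  show ?thesis
    unfolding \<open>R = set E\<close> V[symmetric]
  proof (rule niche_classifiedD[OF E(1)])
    show "set E \<subseteq> set [0..<n] \<times> set [0..<n]"
      using R unfolding \<open>R = set E\<close> V .
    show "(w, u) \<notin> niche_rel (set E)"
      if "(u, v) \<in> niche_rel (set E)" "(v, w) \<in> niche_rel (set E)" for u v w
      using tf that unfolding \<open>R = set E\<close> by blast
    show "S = set [0..<n]" if "S \<subseteq> set [0..<n]" "S \<noteq> {}"
      "\<And>u v. (u, v) \<in> niche_rel (set E) \<Longrightarrow> u \<in> S \<Longrightarrow> v \<in> S" for S
      unfolding V using that unfolding V \<open>R = set E\<close>[symmetric] by (rule conn)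
  qed simp
qed

section \<open>The target graphs\<close>

definition path_list :: "nat \<Rightarrow> nat list \<times> (nat \<times> nat) list" where
  "path_list n = ([0..<n], map (\<lambda>i. (i, Suc i)) [0..<n - 1])"

definition cycle_list :: "nat \<Rightarrow> nat list \<times> (nat \<times> nat) list" where
  "cycle_list n = ([0..<n], map (\<lambda>i. (i, Suc i mod n)) [0..<n])"

definition G4_list :: "nat list \<times> (nat \<times> nat) list" where
  "G4_list = ([0, 1, 2, 3, 4], [(0, 1), (0, 3), (1, 2), (2, 3), (3, 4), (4, 1)])"

definition G5_list :: "nat list \<times> (nat \<times> nat) list" where
  "G5_list = ([1, 2, 3, 4, 5, 6],
     [(1, 2), (2, 3), (3, 4), (4, 5), (5, 6), (6, 1), (1, 4), (2, 5), (3, 6)])"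

text \<open>The last branch serves \<open>k = 5\<close> but also every \<open>k\<close> outside 3,
  4, 5; the restriction on \<open>k\<close> is stated separately wherever it matters.\<close>

definition targets :: "nat \<Rightarrow> (nat list \<times> (nat \<times> nat) list) list" where
  "targets k =
    (if k = 3 then
       [path_list 3, path_list 4, path_list 5, cycle_list 5, cycle_list 6, G4_list, G5_list]
     else if k = 4 then [path_list 4, cycle_list 5]
     else [cycle_list 5])"

lemma list_graph_path_list: "list_graph (path_list n) = path_graph n"
  by (auto simp: path_graph_def list_graph_def path_list_def symcl_def image_iff)

lemma list_graph_cycle_list: "list_graph (cycle_list n) = cycle_graph n"
  by (auto simp: cycle_graph_def list_graph_def cycle_list_def symcl_def image_iff)

lemma list_graph_G4_list: "list_graph G4_list = G4"
  by (simp add: list_graph_def G4_list_def G4_def)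

lemma list_graph_G5_list: "list_graph G5_list = G5"
  by (simp add: list_graph_def G5_list_def G5_def)

lemma list_graph_targets:
  "list_graph ` set (targets 3) =
    {path_graph 3, path_graph 4, path_graph 5, cycle_graph 5, cycle_graph 6, G4, G5}"
  "list_graph ` set (targets 4) = {path_graph 4, cycle_graph 5}"
  "list_graph ` set (targets 5) = {cycle_graph 5}"
  by (simp_all add: targets_def list_graph_path_list list_graph_cycle_list
      list_graph_G4_list list_graph_G5_list)

lemma pair_wf_list_graph:
  "set (snd H) \<subseteq> set (fst H) \<times> set (fst H) \<Longrightarrow> pair_wf_digraph (list_graph H)"
  by unfold_locales (auto simp: list_graph_def symcl_def)

lemma targets_wf:
  assumes "H \<in> set (targets k)"
  shows "distinct (fst H)" "set (snd H) \<subseteq> set (fst H) \<times> set (fst H)"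
  using assms by (auto simp: targets_def path_list_def cycle_list_def G4_list_def G5_list_def
      distinct_map split: if_splits)

section \<open>Certificates that the targets are niche graphs\<close>

text \<open>A certificate decidable by evaluation: \<open>Ls\<close> are the parts and
  \<open>E\<close> the arcs of a tournament on the vertices of \<open>H\<close>. Its niche graph is
  to equal \<open>H\<close> itself, not just an isomorphic copy.\<close>

definition realizes ::
  "'a list list \<Rightarrow> ('a \<times> 'a) list \<Rightarrow> 'a list \<times> ('a \<times> 'a) list \<Rightarrow> bool" where
  "realizes Ls E H \<longleftrightarrow> distinct (concat Ls) \<and> [] \<notin> set Ls \<and>
     (\<forall>v\<in>set (fst H). v \<in> set (concat Ls)) \<and> (\<forall>v\<in>set (concat Ls). v \<in> set (fst H)) \<and>
     (\<forall>e\<in>set E. fst e \<in> set (fst H) \<and> snd e \<in> set (fst H) \<and> (snd e, fst e) \<notin> set E) \<and>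
     (\<forall>p\<in>set (List.product (fst H) (fst H)).
        (p \<in> set E \<or> (snd p, fst p) \<in> set E \<longleftrightarrow>
           \<not> (\<exists>L\<in>set Ls. fst p \<in> set L \<and> snd p \<in> set L)) \<and>
        (niche_pair E p \<longleftrightarrow> p \<in> set (snd H) \<or> (snd p, fst p) \<in> set (snd H)))"

lemma realizesD:
  assumes "realizes Ls E H" "set (snd H) \<subseteq> set (fst H) \<times> set (fst H)"
  defines "D \<equiv> \<lparr> pverts = set (fst H), parcs = set E \<rparr>"
  shows "multipartite_tournament (length Ls) D" "niche_graph D = list_graph H"
proof -
  let ?V = "set (fst H)" and ?P = "set ` set Ls"
  have dist: "distinct (concat Ls)" and ne: "[] \<notin> set Ls" and V: "set (concat Ls) = ?V"
    using assms(1) unfolding realizes_def by auto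
  have E: "set E \<subseteq> ?V \<times> ?V" and asym: "\<And>u v. (u, v) \<in> set E \<Longrightarrow> (v, u) \<notin> set E"
    using assms(1) unfolding realizes_def by auto
  have cross: "(u, v) \<in> set E \<or> (v, u) \<in> set E \<longleftrightarrow> \<not> (\<exists>A\<in>?P. u \<in> A \<and> v \<in> A)"
    and niche: "(u, v) \<in> niche_rel (set E) \<longleftrightarrow> (u, v) \<in> symcl (set (snd H))"
    if "u \<in> ?V" "v \<in> ?V" for u v
    using assms(1) that unfolding realizes_def niche_pair_iff symcl_def by auto
  \<comment> \<open>The underlying complete multipartite graph.\<close>
  define K where "K = \<lparr> pverts = ?V, parcs = set E \<union> (set E)\<inverse> \<rparr>"
  have "distinct Ls" and disj: "\<And>L M. L \<in> set Ls \<Longrightarrow> M \<in> set Ls \<Longrightarrow> L \<noteq> M \<Longrightarrow> set L \<inter> set M = {}"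
    using dist ne by (auto simp: distinct_concat_iff removeAll_id)
  \<comment> \<open>Disjoint nonempty lists have different sets, so no parts collapse when
    counted.\<close>
  have "inj_on set (set Ls)"
    using disj ne by (intro inj_onI) (metis inf.idem set_empty)
  then have "card ?P = length Ls"
    using \<open>distinct Ls\<close> by (simp add: card_image distinct_card)
  moreover have "partition_on ?V ?P"
    using V ne disj by (intro partition_onI) (auto simp: disjnt_def)
  moreover have "pair_graph K"
  proof unfold_locales
    fix e assume e: "e \<in> parcs K"
    \<comment> \<open>A loop would be its own reverse.\<close>
    have "set E \<subseteq> - Id" using asym by auto
    with e E show "fst e \<in> pverts K" "snd e \<in> pverts K" "fst e \<noteq> snd e"
      by (auto simp: K_def) (metis ComplD IdI prod.collapse subsetD)
  qed (auto simp: K_def symmetric_def sym_def)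
  moreover have "parcs K = {(u, v). u \<in> ?V \<and> v \<in> ?V \<and> \<not> (\<exists>A\<in>?P. u \<in> A \<and> v \<in> A)}"
    using E cross unfolding K_def by (simp add: set_eq_iff) blast
  ultimately have "complete_multipartite (length Ls) K"
    unfolding complete_multipartite_def by (auto simp: K_def)
  moreover have "orientation_of D K"
    using asym unfolding orientation_of_def D_def K_def by auto
  ultimately show "multipartite_tournament (length Ls) D"
    unfolding multipartite_tournament_def by blast
  have "niche_rel (set E) \<subseteq> ?V \<times> ?V"
    using niche_rel_subset[OF E] .
  moreover have "symcl (set (snd H)) \<subseteq> ?V \<times> ?V"
    using assms(2) by (auto simp: symcl_def)
  ultimately have "niche_rel (set E) = symcl (set (snd H))"
    using niche by auto
  then show "niche_graph D = list_graph H"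
    using parcs_niche_graph[of D] E pverts_niche_graph[of D]
    by (auto simp: D_def list_graph_def)
qed

text \<open>Listed in the order of \<open>targets\<close>. The witnesses for \<open>C_5\<close> and
  for \<open>P_3\<close>, \<open>P_4\<close> are subdigraphs of the circular tournament with arcs
  from \<open>i\<close> to \<open>i + 1\<close> and \<open>i + 2\<close> modulo 5; the one for
  \<open>C_6\<close> follows the same rule modulo 6.\<close>

definition witnesses :: "nat \<Rightarrow> (nat list list \<times> (nat \<times> nat) list) list" where
  "witnesses k =
    (if k = 3 then
      [([[0], [1], [2]], [(0, 1), (0, 2), (1, 2)]),
       ([[0], [1], [2, 3]], [(0, 1), (0, 2), (1, 2), (3, 0), (1, 3)]),
       ([[2], [0, 1], [4, 3]], [(2, 0), (2, 1), (4, 2), (0, 4), (1, 4), (3, 2), (0, 3), (3, 1)]),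
       ([[0], [1], [2, 3, 4]], [(0, 1), (0, 2), (1, 2), (3, 0), (1, 3), (4, 0), (4, 1)]),
       ([[0, 3], [1, 4], [2, 5]],
        [(0, 1), (1, 3), (4, 0), (3, 4), (0, 2), (2, 3), (1, 2), (2, 4), (5, 0), (3, 5), (5, 1), (4, 5)]),
       ([[0], [1, 2], [4, 3]], [(0, 1), (2, 0), (0, 4), (1, 4), (4, 2), (3, 0), (1, 3), (2, 3)]),
       ([[1, 2], [3, 4], [6, 5]],
        [(1, 3), (2, 3), (1, 4), (4, 2), (6, 1), (2, 6), (3, 6), (6, 4), (5, 1), (5, 2), (3, 5), (4, 5)])]
     else if k = 4 then
      [([[0], [1], [2], [3]], [(0, 1), (0, 2), (1, 2), (3, 0), (1, 3), (2, 3)]),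
       ([[0], [1], [2], [3, 4]],
        [(0, 1), (0, 2), (1, 2), (3, 0), (1, 3), (2, 3), (4, 0), (4, 1), (2, 4)])]
     else
      [([[0], [1], [2], [3], [4]],
        [(0, 1), (0, 2), (1, 2), (3, 0), (1, 3), (2, 3), (4, 0), (4, 1), (2, 4), (3, 4)])])"

definition all_realized :: "nat \<Rightarrow> bool" where
  "all_realized k \<longleftrightarrow>
     list_all2 (\<lambda>w H. length (fst w) = k \<and> realizes (fst w) (snd w) H) (witnesses k) (targets k)"

lemma all_realized: "all_realized 3" "all_realized 4" "all_realized 5"
  by code_simp+

lemma targets_realized:
  assumes "k \<in> {3, 4, 5}" "H \<in> set (targets k)"
  shows "\<exists>D. multipartite_tournament k D \<and> niche_graph D = list_graph H"
proof -
  have "all_realized k" using assms(1) all_realized by auto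
  then obtain w where "length (fst w) = k" "realizes (fst w) (snd w) H"
    using assms(2) unfolding all_realized_def list_all2_conv_all_nth
    by (metis in_set_conv_nth)
  then show ?thesis
    using realizesD targets_wf(2)[OF assms(2)] by blast
qed

section \<open>Bounds on the part sizes\<close>

lemma multipartite_tournamentE:
  assumes "multipartite_tournament k D"
  obtains P where "partition_on (pverts D) P" "card P = k" "finite (pverts D)"
    "parcs D \<subseteq> pverts D \<times> pverts D" "\<And>u v. (u, v) \<in> parcs D \<Longrightarrow> (v, u) \<notin> parcs D"
    "\<And>u v. u \<in> pverts D \<Longrightarrow> v \<in> pverts D \<Longrightarrow>
       (u, v) \<in> parcs D \<or> (v, u) \<in> parcs D \<longleftrightarrow> \<not> (\<exists>A\<in>P. u \<in> A \<and> v \<in> A)"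
proof -
  obtain K P where K: "pair_graph K" "partition_on (pverts K) P" "card P = k"
    "parcs K = {(u, v). u \<in> pverts K \<and> v \<in> pverts K \<and> \<not> (\<exists>A\<in>P. u \<in> A \<and> v \<in> A)}"
    and D: "pverts D = pverts K" "parcs D \<union> (parcs D)\<inverse> = parcs K" "parcs D \<inter> (parcs D)\<inverse> = {}"
    using assms unfolding multipartite_tournament_def complete_multipartite_def orientation_of_def
    by blast
  interpret pair_graph K by fact
  show ?thesis
  proof (rule that[of P])
    show "finite (pverts D)" using D(1) pair_finite_verts by simp
    show "parcs D \<subseteq> pverts D \<times> pverts D" using D(1,2) K(4) by auto
    show "(v, u) \<notin> parcs D" if "(u, v) \<in> parcs D" for u v using D(3) that by auto
    show "(u, v) \<in> parcs D \<or> (v, u) \<in> parcs D \<longleftrightarrow> \<not> (\<exists>A\<in>P. u \<in> A \<and> v \<in> A)"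
      if "u \<in> pverts D" "v \<in> pverts D" for u v
    proof -
      have "(u, v) \<in> parcs D \<or> (v, u) \<in> parcs D \<longleftrightarrow> (u, v) \<in> parcs K"
        using D(2) by auto
      then show ?thesis using that D(1) K(4) by simp
    qed
  qed (use K D in auto)
qed

text \<open>Any three out-neighbours of \<open>u\<close> share the in-neighbour \<open>u\<close>, so
  they would be pairwise adjacent.\<close>

lemma card_Image_le_2:
  assumes "\<And>u v w. (u, v) \<in> niche_rel R \<Longrightarrow> (v, w) \<in> niche_rel R \<Longrightarrow> (w, u) \<notin> niche_rel R"
  shows "card (R `` {u}) \<le> 2"
proof (rule ccontr)
  assume "\<not> card (R `` {u}) \<le> 2"
  then obtain T where "T \<subseteq> R `` {u}" "card T = 3"
    by (metis obtain_subset_with_card_n not_less_eq_eq numeral_3_eq_3 numeral_2_eq_2)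
  then obtain x y z where "{x, y, z} \<subseteq> R `` {u}" "x \<noteq> y" "y \<noteq> z" "x \<noteq> z"
    by (auto simp: card_3_iff)
  then have "(x, y) \<in> niche_rel R" "(y, z) \<in> niche_rel R" "(z, x) \<in> niche_rel R"
    unfolding niche_rel_def by auto
  then show False using assms by blast
qed

text \<open>Reversing all arcs swaps the two clauses; this turns the out-degree bound into the
  in-degree bound.\<close>

lemma niche_rel_converse: "niche_rel (R\<inverse>) = niche_rel R"
  by (auto simp: niche_rel_def)

text \<open>The bound is strongest for the smallest part: the others together have at most four
  vertices, and each has at least one.\<close>

lemma part_sizes:
  fixes ss :: "nat list"
  assumes "sorted ss" "length ss \<ge> 3" "\<forall>s\<in>set ss. s \<ge> 1" "\<forall>s\<in>set ss. sum_list ss \<le> s + 4"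
  shows "ss \<in> {[1, 1, 1], [1, 1, 2], [1, 1, 3], [1, 2, 2], [2, 2, 2],
    [1, 1, 1, 1], [1, 1, 1, 2], [1, 1, 1, 1, 1]}"
proof -
  obtain s ts where ss: "ss = s # ts" using assms(2) by (cases ss) auto
  have "length ts \<le> sum_list ts"
    using sum_list_mono[of ts "\<lambda>_. 1" "\<lambda>x. x"] assms(3) ss by (simp add: sum_list_triv)
  moreover have "sum_list ts \<le> 4" using assms(4) ss by auto
  ultimately have "length ss = 3 \<or> length ss = 4 \<or> length ss = 5"
    using assms(2) ss by auto
  then consider a b c where "ss = [a, b, c]" | a b c d where "ss = [a, b, c, d]"
    | a b c d e where "ss = [a, b, c, d, e]"
    by (auto simp: eval_nat_numeral length_Suc_conv)
  then show ?thesis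
  proof cases
    case 1
    then have "1 \<le> a" "a \<le> b" "b \<le> c" "b + c \<le> 4" using assms by auto
    then have "(a = 1 \<and> b = 1 \<and> c = 1) \<or> (a = 1 \<and> b = 1 \<and> c = 2) \<or> (a = 1 \<and> b = 1 \<and> c = 3) \<or>
      (a = 1 \<and> b = 2 \<and> c = 2) \<or> (a = 2 \<and> b = 2 \<and> c = 2)" by presburger
    then show ?thesis using 1 by auto
  next
    case 2
    then have "1 \<le> a" "a \<le> b" "b \<le> c" "c \<le> d" "b + c + d \<le> 4" using assms by auto
    then have "a = 1 \<and> b = 1 \<and> c = 1 \<and> (d = 1 \<or> d = 2)" by presburger
    then show ?thesis using 2 by auto
  next
    case 3
    then have "1 \<le> a" "1 \<le> b" "1 \<le> c" "1 \<le> d" "1 \<le> e" "a \<le> b" "b + c + d + e \<le> 4"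
      using assms by auto
    then have "a = 1 \<and> b = 1 \<and> c = 1 \<and> d = 1 \<and> e = 1" by presburger
    then show ?thesis using 3 by auto
  qed
qed

section \<open>Outcome of the search and transfer to arbitrary tournaments\<close>

lemma check_parts_targets:
  "check_parts (targets 3) [1, 1, 1]"
  "check_parts (targets 3) [1, 1, 2]"
  "check_parts (targets 3) [1, 1, 3]"
  "check_parts (targets 3) [1, 2, 2]"
  "check_parts (targets 3) [2, 2, 2]"
  "check_parts (targets 4) [1, 1, 1, 1]"
  "check_parts (targets 4) [1, 1, 1, 2]"
  "check_parts (targets 5) [1, 1, 1, 1, 1]"
  by code_simp+

text \<open>The vertices are laid out part by part, so that the position of a vertex determines its
  part in the way \<open>colours\<close> prescribes.\<close>

lemma multipartite_tournament_listsE: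
  assumes "multipartite_tournament k D" and deg: "\<And>u. card (parcs D `` {u}) \<le> 2"
    "\<And>u. card ((parcs D)\<inverse> `` {u}) \<le> 2"
  obtains vs ss where "distinct vs" "set vs = pverts D" "length vs = length (colours 0 ss)"
    "sorted ss" "length ss = k" "\<forall>s\<in>set ss. s \<ge> 1" "\<forall>s\<in>set ss. sum_list ss \<le> s + 4"
    "\<And>i j. i < length vs \<Longrightarrow> j < length vs \<Longrightarrow>
       (vs ! i, vs ! j) \<in> parcs D \<or> (vs ! j, vs ! i) \<in> parcs D \<longleftrightarrow>
       colours 0 ss ! i \<noteq> colours 0 ss ! j"
proof -
  obtain P where P: "partition_on (pverts D) P" "card P = k" and fin: "finite (pverts D)"
    and sub: "parcs D \<subseteq> pverts D \<times> pverts D"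
    and cross: "\<And>u v. u \<in> pverts D \<Longrightarrow> v \<in> pverts D \<Longrightarrow>
       (u, v) \<in> parcs D \<or> (v, u) \<in> parcs D \<longleftrightarrow> \<not> (\<exists>A\<in>P. u \<in> A \<and> v \<in> A)"
    using multipartite_tournamentE[OF assms(1)] by blast
  have finP: "finite P" using finite_elements[OF fin P(1)] .
  have finA: "finite A" if "A \<in> P" for A
    using that partition_onD1[OF P(1)] finite_subset[OF _ fin] by blast
  have same: "A = B" if "A \<in> P" "B \<in> P" "v \<in> A" "v \<in> B" for A B v
    using disjointD[OF partition_onD2[OF P(1)] that(1,2)] that(3,4) by blast
  \<comment> \<open>Sorting the parts by size leaves one list of sizes per multiset.\<close>
  obtain ps0 where "set ps0 = P" "distinct ps0"
    using finP finite_distinct_list by blast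
  then obtain ps where ps: "set ps = P" "distinct ps" "sorted (map card ps)"
    using that[of "sort_key card ps0"] by (metis distinct_sort set_sort sorted_sort_key)
  define lss where "lss = map (\<lambda>A. SOME l. set l = A \<and> distinct l) ps"
  have "set (SOME l. set l = A \<and> distinct l) = A \<and> distinct (SOME l. set l = A \<and> distinct l)"
    if "A \<in> P" for A
    using someI_ex[OF finite_distinct_list[OF finA[OF that]]] .
  then have lss: "length lss = length ps" "map set lss = ps" "\<forall>l\<in>set lss. distinct l"
    using ps(1) by (auto simp: lss_def intro: map_idI)
  define vs where "vs = concat lss"
  define ss where "ss = map length lss"
  have ss: "ss = map card ps"
    using lss(3) by (auto simp: ss_def distinct_card simp flip: lss(2))
  have vs: "set vs = pverts D"
    using P(1) ps(1) by (auto simp: vs_def partition_on_def simp flip: lss(2))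
  have lenc: "length (colours 0 ss) = length vs"
    unfolding ss_def vs_def by (rule colours_concat)
  have part: "vs ! i \<in> ps ! (colours 0 ss ! i)" "colours 0 ss ! i < length ps"
    if i: "i < length vs" for i
  proof -
    obtain m where m: "m < length lss" "colours 0 ss ! i = m" "vs ! i \<in> set (lss ! m)"
      using colours_concat(2)[of i lss 0] i unfolding vs_def ss_def by auto
    have "ps ! m = set (lss ! m)"
      using nth_map[OF m(1), of set] lss(2) by simp
    then show "vs ! i \<in> ps ! (colours 0 ss ! i)" "colours 0 ss ! i < length ps"
      using m lss(1) by simp_all
  qed
  have card_ps: "card A \<ge> 1" "card (pverts D) \<le> card A + 4" if "A \<in> P" for A
  proof -
    have "A \<noteq> {}" using P(1) that by (auto simp: partition_on_def)
    then obtain v where v: "v \<in> A" by blast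
    then show "card A \<ge> 1" using finA[OF that] by (auto simp: Suc_le_eq card_gt_0_iff)
    \<comment> \<open>Hence every vertex outside \<open>A\<close> is an out- or in-neighbour of
      \<open>v\<close>, and there are at most two of each.\<close>
    have "u \<in> A" if u: "u \<in> pverts D" "(u, v) \<notin> parcs D" "(v, u) \<notin> parcs D" for u
    proof -
      have "v \<in> pverts D" using P(1) v \<open>A \<in> P\<close> by (auto simp: partition_on_def)
      then obtain B where "B \<in> P" "u \<in> B" "v \<in> B" using cross u by blast
      then show ?thesis using same v \<open>A \<in> P\<close> by blast
    qed
    then have "pverts D \<subseteq> A \<union> (parcs D `` {v} \<union> (parcs D)\<inverse> `` {v})" by blast
    moreover have "finite (parcs D)" using sub fin finite_subset by blast
    ultimately have "card (pverts D) \<le> card (A \<union> (parcs D `` {v} \<union> (parcs D)\<inverse> `` {v}))"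
      using finA[OF that] by (intro card_mono) auto
    also have "\<dots> \<le> card A + (card (parcs D `` {v}) + card ((parcs D)\<inverse> `` {v}))"
      by (meson add_left_mono card_Un_le order_trans)
    finally show "card (pverts D) \<le> card A + 4" using deg[of v] by linarith
  qed
  have sum: "sum_list ss = card (pverts D)"
  proof -
    have "card (\<Union>P) = sum card P"
      using P(1) finA by (intro card_Union_disjoint)
        (auto simp: partition_on_def disjoint_def pairwise_def disjnt_def)
    moreover have "\<Union>P = pverts D" using P(1) by (auto simp: partition_on_def)
    ultimately show ?thesis
      using ps by (simp add: ss sum_list_distinct_conv_sum_set)
  qed
  \<comment> \<open>A list as long as its set is large has no repetitions.\<close>
  have "length vs = card (pverts D)"
    using sum by (simp add: vs_def ss_def length_concat)
  then have "distinct vs" using vs card_distinct by metis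
  show ?thesis
  proof (rule that[of vs ss])
    show "length ss = k" using P(2) ps by (simp add: ss distinct_card[symmetric])
    show "\<forall>s\<in>set ss. s \<ge> 1" "\<forall>s\<in>set ss. sum_list ss \<le> s + 4"
      using card_ps ps(1) unfolding sum by (auto simp: ss)
    show "sorted ss" using ps(3) by (simp add: ss)
    show "length vs = length (colours 0 ss)" using lenc by simp
    fix i j assume ij: "i < length vs" "j < length vs"
    have mem: "vs ! i \<in> pverts D" "vs ! j \<in> pverts D"
      using ij unfolding vs[symmetric] by simp_all
    \<comment> \<open>Parts are disjoint, so a common part must be the one that the colour of each
      index names.\<close>
    have "(\<exists>A\<in>P. vs ! i \<in> A \<and> vs ! j \<in> A) \<longleftrightarrow> ps ! (colours 0 ss ! i) = ps ! (colours 0 ss ! j)"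
      using part[OF ij(1)] part[OF ij(2)] ps(1) same by (metis nth_mem)
    also have "\<dots> \<longleftrightarrow> colours 0 ss ! i = colours 0 ss ! j"
      using part(2)[OF ij(1)] part(2)[OF ij(2)] ps(2) by (simp add: nth_eq_iff_index_eq)
    finally show "(vs ! i, vs ! j) \<in> parcs D \<or> (vs ! j, vs ! i) \<in> parcs D \<longleftrightarrow>
        colours 0 ss ! i \<noteq> colours 0 ss ! j"
      using cross[OF mem] by simp
  qed fact+
qed

text \<open>The tournament is renumbered to live on \<open>{..<n}\<close>, where the search result
  applies; the match found there is carried back and composed with the given isomorphism.\<close>

lemma niche_realizable_targets:
  assumes G: "pair_graph G" "connected (with_proj G)" "triangle_free G"
    and "k \<ge> 3" "niche_realizable G k"
  shows "k \<in> {3, 4, 5} \<and> (\<exists>H\<in>set (targets k). digraph_iso (with_proj G) (with_proj (list_graph H)))"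
proof -
  interpret pair_graph G by fact
  obtain D :: "nat pair_pre_digraph" where D: "multipartite_tournament k D"
    and iso: "digraph_iso (with_proj G) (with_proj (niche_graph D))"
    using assms(5) unfolding niche_realizable_def by blast
  have sub: "parcs D \<subseteq> pverts D \<times> pverts D"
    and asym: "\<And>u v. (u, v) \<in> parcs D \<Longrightarrow> (v, u) \<notin> parcs D"
    using multipartite_tournamentE[OF D] by blast+
  note N = parcs_niche_graph[OF sub]
  have conN: "connected (with_proj (niche_graph D))"
    using iso G(2) unfolding digraph_iso_def by (metis connectedI_app_iso)
  have "triangle_free (niche_graph D)"
    using triangle_free_iso[OF iso pair_wf_digraph_axioms G(3)] .
  then have tf: "(w, u) \<notin> niche_rel (parcs D)"
    if "(u, v) \<in> niche_rel (parcs D)" "(v, w) \<in> niche_rel (parcs D)" for u v w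
    using that unfolding triangle_free_def N by blast
  have deg: "card (parcs D `` {u}) \<le> 2" "card ((parcs D)\<inverse> `` {u}) \<le> 2" for u
    using card_Image_le_2[of "parcs D"] card_Image_le_2[of "(parcs D)\<inverse>"] tf
    unfolding niche_rel_converse by blast+
  obtain vs ss where vs: "distinct vs" "set vs = pverts D" "length vs = length (colours 0 ss)"
    and ss: "sorted ss" "length ss = k" "\<forall>s\<in>set ss. s \<ge> 1" "\<forall>s\<in>set ss. sum_list ss \<le> s + 4"
    and cross: "\<And>i j. i < length vs \<Longrightarrow> j < length vs \<Longrightarrow>
       (vs ! i, vs ! j) \<in> parcs D \<or> (vs ! j, vs ! i) \<in> parcs D \<longleftrightarrow>
       colours 0 ss ! i \<noteq> colours 0 ss ! j"
    using multipartite_tournament_listsE[OF D deg] by blast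
  have "ss \<in> {[1, 1, 1], [1, 1, 2], [1, 1, 3], [1, 2, 2], [2, 2, 2],
      [1, 1, 1, 1], [1, 1, 1, 2], [1, 1, 1, 1, 1]}"
    using part_sizes[OF ss(1) _ ss(3,4)] ss(2) assms(4) by blast
  \<comment> \<open>The length of the size list is \<open>k\<close>, so each of the eight lists
    selects its own \<open>targets k\<close>.\<close>
  then have k: "k \<in> {3, 4, 5}" and check: "check_parts (targets k) ss"
    using check_parts_targets ss(2) by (auto simp: numeral_eq_Suc)
  define n where "n = length vs"
  define R where "R = {(i, j). i < n \<and> j < n \<and> (vs ! i, vs ! j) \<in> parcs D}"
  have idx: "\<exists>i<n. v = vs ! i" if "v \<in> pverts D" for v
    using that vs(2) by (metis in_set_conv_nth n_def)
  have img: "nth vs ` {..<n} = pverts D"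
    using vs(2) by (auto simp: n_def set_conv_nth)
  have inj: "inj_on (nth vs) {..<n}"
    using vs(1) by (simp add: inj_on_nth n_def)
  \<comment> \<open>Every common neighbour in \<open>D\<close> is a vertex and so has an index, by
    \<open>sub\<close> and \<open>idx\<close>.\<close>
  have nR: "(i, j) \<in> niche_rel R \<longleftrightarrow> (vs ! i, vs ! j) \<in> niche_rel (parcs D)"
    if "i < n" "j < n" for i j
  proof -
    have "vs ! i = vs ! j \<longleftrightarrow> i = j" using inj that by (auto dest: inj_onD)
    moreover have "(\<exists>w. (i, w) \<in> R \<and> (j, w) \<in> R) \<longleftrightarrow>
        (\<exists>w. (vs ! i, w) \<in> parcs D \<and> (vs ! j, w) \<in> parcs D)"
      using idx sub that unfolding R_def by blast
    moreover have "(\<exists>w. (w, i) \<in> R \<and> (w, j) \<in> R) \<longleftrightarrow>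
        (\<exists>w. (w, vs ! i) \<in> parcs D \<and> (w, vs ! j) \<in> parcs D)"
      using idx sub that unfolding R_def by blast
    ultimately show ?thesis unfolding niche_rel_def by simp
  qed
  have R: "R \<subseteq> {..<n} \<times> {..<n}" by (auto simp: R_def)
  note nR_sub = niche_rel_subset[OF R]
  have "\<exists>p H. H \<in> set (targets k) \<and> distinct p \<and> set p = {..<n} \<and> length p = length (fst H) \<and>
    (\<forall>i<length p. \<forall>j<length p.
       (p ! i, p ! j) \<in> niche_rel R \<longleftrightarrow> (fst H ! i, fst H ! j) \<in> symcl (set (snd H)))"
  proof (rule check_partsD[OF check R refl])
    show "n = length (colours 0 ss)" using vs(3) by (simp add: n_def)
    show "(i, j) \<in> R \<or> (j, i) \<in> R \<longleftrightarrow> colours 0 ss ! i \<noteq> colours 0 ss ! j" if "i < n" "j < n" for i j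
      using cross that by (simp add: R_def n_def)
    show "(j, i) \<notin> R" if "(i, j) \<in> R" for i j
      using asym that by (auto simp: R_def)
    show tfR: "(w, u) \<notin> niche_rel R" if "(u, v) \<in> niche_rel R" "(v, w) \<in> niche_rel R" for u v w
    proof -
      have "u < n" "v < n" "w < n" using that nR_sub by auto
      then show ?thesis using that nR tf by blast
    qed
    show "card (R `` {u}) \<le> 2" for u
      using card_Image_le_2[of R] tfR by blast
    show "card (R\<inverse> `` {u}) \<le> 2" for u
      using card_Image_le_2[of "R\<inverse>"] tfR unfolding niche_rel_converse by blast
    fix S assume S: "S \<subseteq> {..<n}" "S \<noteq> {}"
      and closed: "\<And>u v. (u, v) \<in> niche_rel R \<Longrightarrow> u \<in> S \<Longrightarrow> v \<in> S"
    \<comment> \<open>Closedness of \<open>S\<close> passes to its image in the connected graph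
      \<open>niche_graph D\<close>; injectivity of \<open>nth vs\<close> then returns the equality
      to indices.\<close>
    have "nth vs ` S = pverts (niche_graph D)"
    proof (rule connected_closed_set[OF conN pair_wf_niche_graph])
      show "nth vs ` S \<subseteq> pverts (niche_graph D)"
        using S(1) nth_mem[of _ vs] vs(2) by (auto simp: n_def)
      show "nth vs ` S \<noteq> {}" using S(2) by simp
      show "(v, u) \<in> parcs (niche_graph D)" if "(u, v) \<in> parcs (niche_graph D)" for u v
        using that niche_rel_sym unfolding N by metis
      show "v \<in> nth vs ` S" if uv: "(u, v) \<in> parcs (niche_graph D)" "u \<in> nth vs ` S" for u v
      proof -
        obtain i where i: "i \<in> S" "u = vs ! i" using uv(2) by blast
        have "v \<in> pverts D" using uv(1) niche_rel_subset[OF sub] unfolding N by blast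
        then obtain j where j: "j < n" "v = vs ! j" using idx by blast
        have "(i, j) \<in> niche_rel R" using nR uv(1) i j S(1) unfolding N by blast
        then show ?thesis using closed i j by blast
      qed
    qed
    with img show "S = {..<n}"
      using inj_on_image_eq_iff[OF inj S(1) order_refl] by simp
  qed
  then obtain p H where H: "H \<in> set (targets k)" and p: "distinct p" "set p = {..<n}"
    "length p = length (fst H)" and match: "\<And>i j. i < length p \<Longrightarrow> j < length p \<Longrightarrow>
       (p ! i, p ! j) \<in> niche_rel R \<longleftrightarrow> (fst H ! i, fst H ! j) \<in> symcl (set (snd H))"
    by blast
  have "digraph_iso (with_proj (niche_graph D)) (with_proj (list_graph H))"
  \<comment> \<open>Vertex number \<open>i\<close> of the target corresponds to
    \<open>vs ! (p ! i)\<close>.\<close>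
  proof (rule digraph_iso_listsI[OF pair_wf_niche_graph, of "map (nth vs) p" _ _ "fst H"])
    show "distinct (map (nth vs) p)" using p inj by (simp add: distinct_map)
    show "set (map (nth vs) p) = pverts (niche_graph D)"
      using p(2) img by simp
    show "pair_wf_digraph (list_graph H)" using targets_wf[OF H] by (intro pair_wf_list_graph)
    show "distinct (fst H)" using targets_wf[OF H] by blast
    fix i j assume "i < length (map (nth vs) p)" "j < length (map (nth vs) p)"
    then have "i < length p" "j < length p" by simp_all
    moreover from this have "p ! i < n" "p ! j < n" using p(2) nth_mem by blast+
    ultimately show "(map (nth vs) p ! i, map (nth vs) p ! j) \<in> parcs (niche_graph D) \<longleftrightarrow>
        (fst H ! i, fst H ! j) \<in> parcs (list_graph H)"
      using match[of i j] nR[of "p ! i" "p ! j"] by (simp add: N list_graph_def)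
  qed (use p(3) in \<open>auto simp: list_graph_def\<close>)
  then show ?thesis using k H digraph_iso_trans[OF iso] by blast
qed

lemma targets_niche_realizable:
  assumes "k \<in> {3, 4, 5}" "H \<in> set (targets k)"
    "digraph_iso (with_proj G) (with_proj (list_graph H))"
  shows "niche_realizable G k"
  using targets_realized[OF assms(1,2)] assms(3) unfolding niche_realizable_def by metis

theorem theorem4p12:
  fixes G :: "'a pair_pre_digraph" and k :: nat
  assumes "pair_graph G"
    and "connected (with_proj G)"
    and "triangle_free G"
    and "card (pverts G) \<ge> 3"
    and "k \<ge> 3"
  shows "niche_realizable G k \<longleftrightarrow>
    k \<in> {3, 4, 5} \<and>
    (k = 3 \<longrightarrow> (\<exists>H \<in> {path_graph 3, path_graph 4, path_graph 5, cycle_graph 5, cycle_graph 6, G4, G5}.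
                  digraph_iso (with_proj G) (with_proj H))) \<and>
    (k = 4 \<longrightarrow> (\<exists>H \<in> {path_graph 4, cycle_graph 5}. digraph_iso (with_proj G) (with_proj H))) \<and>
    (k = 5 \<longrightarrow> (\<exists>H \<in> {cycle_graph 5}. digraph_iso (with_proj G) (with_proj H)))"
proof -
  define T where "T = list_graph ` set (targets k)"
  have "niche_realizable G k \<longleftrightarrow> k \<in> {3, 4, 5} \<and>
      (\<exists>H\<in>T. digraph_iso (with_proj G) (with_proj H))"
    using niche_realizable_targets[OF assms(1-3,5)] targets_niche_realizable
    unfolding T_def by blast
  moreover have
    "k = 3 \<Longrightarrow> T =
      {path_graph 3, path_graph 4, path_graph 5, cycle_graph 5, cycle_graph 6, G4, G5}"
    "k = 4 \<Longrightarrow> T = {path_graph 4, cycle_graph 5}"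
    "k = 5 \<Longrightarrow> T = {cycle_graph 5}"
    by (simp_all only: T_def list_graph_targets)
  ultimately show ?thesis
    \<comment> \<open>For each \<open>k\<close> only one of the three implications has a true
      premise, and its set of graphs is \<open>T\<close>.\<close>
    by (cases "k = 3"; cases "k = 4"; cases "k = 5"; simp)
qed

end
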